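(* Assume $\mu_i\ne\mu_j$ for $i\ne j$. Then for every $y\in B$, $$\mathbb P_y(\tau<\infty)=\sum_{d=1}^{D}\left(\prod_{l=d+1}^{D}\frac{\mu_l-\lambda}{\mu_l-\mu_d}\right)h_d^*(y).$$
   Context: Let $D\ge3$ be an integer (the dimension), $\lambda,\mu_1,\dots,\mu_D>0$ with $\lambda+\sum_i\mu_i=1$, $\lambda<\mu_i$ for all $i$, and $\rho_i=\lambda/\mu_i$. Let $e_1,\dots,e_D$ be the standard basis of $\mathbb Z^D$ and $\Omega_Y=\mathbb Z\times\mathbb Z_+^{D-1}$. Let $J_1,J_2,\dots$ be i.i.d. with $\mathbb P(J_k=-e_1)=\lambda$, $\mathbb P(J_k=e_1+e_2)=\mu_1$, $\mathbb P(J_k=-e_i+e_{i+1})=\mu_i$ for $2\le i\le D-1$, $\mathbb P(J_k=-e_D)=\mu_D$. The process $Y$ on $\Omega_Y$ is $Y_{k+1}=Y_k+\pi_1(Y_k,J_{k+1})$, where $\pi_1(y,v)=v$ if $y+v\in\Omega_Y$ and $0$ otherwise. $\mathbb P_y$ is the law with $Y_0=y$. $B=\{y\in\Omega_Y:y(1)\ge\sum_{j=2}^Dy(j)\}$, $\partial B=\{y\in\Omega_Y:y(1)=\sum_{j=2}^Dy(j)\}$, $\tau=\inf\{k\ge0:Y_k\in\partial B\}$. For $\beta\in\mathbb C$ and $\alpha=(\alpha(2),\dots,\alpha(D))$, $[(\beta,\alpha),y]=\beta^{\,y(1)-\sum_{j=2}^Dy(j)}\prod_{j=2}^D\alpha(j)^{y(j)}$.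 For a nonempty $a\subset\{1,\dots,D\}$ with elements $a(1)<a(2)<\dots<a(|a|)$ put $$c_a^*=(-1)^{|a|-1}\prod_{j=1}^{|a|-1}\ \prod_{l=a(j)+1}^{a(j+1)}\frac{\mu_l-\lambda}{\mu_l-\mu_{a(j)}},$$ and for $l\in\{2,\dots,D\}$: $\alpha_a^*(l)=1$ if $l\le a(1)$; $\alpha_a^*(l)=\rho_{a(j)}$ if $a(j)<l\le a(j+1)$; $\alpha_a^*(l)=\rho_{a(|a|)}$ if $l>a(|a|)$. For $d\in\{1,\dots,D\}$, $$h_d^*(y)=\sum_{a\subset\{1,\dots,d-1\}}c^*_{a\cup\{d\}}\,[(\rho_d,\alpha^*_{a\cup\{d\}}),y].$$ Empty products equal $1$; the sum includes $a=\emptyset$. *)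

theory Defs
  imports "HOL-Probability.Probability" "HOL-Library.Extended_Nat" "HOL-Library.Function_Algebras"
begin

text \<open>
  Elements of \<open>\<int>\<^sup>D\<close> are functions \<open>nat \<Rightarrow> int\<close> that vanish outside
  the coordinates \<open>1, \<dots>, D\<close>; addition, negation and zero are pointwise
  (\<^theory>\<open>HOL-Library.Function_Algebras\<close>).
\<close>

definition int_lattice :: "nat \<Rightarrow> (nat \<Rightarrow> int) set" where
  "int_lattice D = {v. \<forall>i. i \<notin> {1..D} \<longrightarrow> v i = 0}"

definition e :: "nat \<Rightarrow> nat \<Rightarrow> int" where
  "e i = (\<lambda>j. if j = i then 1 else 0)"

definition Omega_Y :: "nat \<Rightarrow> (nat \<Rightarrow> int) set" where
  "Omega_Y D = {y \<in> int_lattice D. \<forall>i\<in>{2..D}. 0 \<le> y i}"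

definition pi1 :: "nat \<Rightarrow> (nat \<Rightarrow> int) \<Rightarrow> (nat \<Rightarrow> int) \<Rightarrow> (nat \<Rightarrow> int)" where
  "pi1 D y v = (if y + v \<in> Omega_Y D then v else 0)"

text \<open>
  The path started at \<open>y\<close> and driven by the increments \<open>v 1, v 2, \<dots>\<close>;
  \<open>v 0\<close> is not used.
\<close>

primrec Y :: "nat \<Rightarrow> (nat \<Rightarrow> int) \<Rightarrow> (nat \<Rightarrow> nat \<Rightarrow> int) \<Rightarrow> nat \<Rightarrow> (nat \<Rightarrow> int)" where
  "Y D y v 0 = y"
| "Y D y v (Suc k) = Y D y v k + pi1 D (Y D y v k) (v (Suc k))"

definition B :: "nat \<Rightarrow> (nat \<Rightarrow> int) set" where
  "B D = {y \<in> Omega_Y D. y 1 \<ge> (\<Sum>j=2..D. y j)}"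

definition bdry_B :: "nat \<Rightarrow> (nat \<Rightarrow> int) set" where
  "bdry_B D = {y \<in> Omega_Y D. y 1 = (\<Sum>j=2..D. y j)}"

text \<open>The infimum of the empty set in \<^typ>\<open>enat\<close> is \<open>\<infinity>\<close>.\<close>

definition tau :: "nat \<Rightarrow> (nat \<Rightarrow> nat \<Rightarrow> int) \<Rightarrow> enat" where
  "tau D p = Inf {enat k |k. p k \<in> bdry_B D}"

text \<open>
  The bracket \<open>[(\<beta>, \<alpha>), y]\<close>, over an arbitrary field: the functions \<open>h\<^sub>d\<^sup>*\<close>
  below only need it over the reals, since \<open>\<rho>\<^sub>d\<close> is real.
\<close>

definition bracket :: "nat \<Rightarrow> 'a::field \<Rightarrow> (nat \<Rightarrow> 'a) \<Rightarrow> (nat \<Rightarrow> int) \<Rightarrow> 'a" where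
  "bracket D \<beta> \<alpha> y =
     \<beta> powi (y 1 - (\<Sum>j=2..D. y j)) * (\<Prod>j=2..D. \<alpha> j powi y j)"

definition rho :: "real \<Rightarrow> (nat \<Rightarrow> real) \<Rightarrow> nat \<Rightarrow> real" where
  "rho lam \<mu> i = lam / \<mu> i"

text \<open>\<open>elt a j\<close> is the \<open>j\<close>-th smallest element \<open>a(j)\<close> of \<open>a\<close>, for \<open>1 \<le> j \<le> card a\<close>.\<close>

definition elt :: "nat set \<Rightarrow> nat \<Rightarrow> nat" where
  "elt a j = sorted_list_of_set a ! (j - 1)"

definition c_star :: "real \<Rightarrow> (nat \<Rightarrow> real) \<Rightarrow> nat set \<Rightarrow> real" where
  "c_star lam \<mu> a = (-1) ^ (card a - 1) *
     (\<Prod>j=1..card a - 1. \<Prod>l=elt a j + 1..elt a (j + 1). (\<mu> l - lam) / (\<mu> l - \<mu> (elt a j)))"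

definition alpha_star :: "real \<Rightarrow> (nat \<Rightarrow> real) \<Rightarrow> nat set \<Rightarrow> nat \<Rightarrow> real" where
  "alpha_star lam \<mu> a l =
     (if l \<le> elt a 1 then 1
      else if l > elt a (card a) then rho lam \<mu> (elt a (card a))
      else rho lam \<mu> (elt a (THE j. j \<in> {1..<card a} \<and> elt a j < l \<and> l \<le> elt a (j + 1))))"

definition h_star :: "nat \<Rightarrow> real \<Rightarrow> (nat \<Rightarrow> real) \<Rightarrow> nat \<Rightarrow> (nat \<Rightarrow> int) \<Rightarrow> real" where
  "h_star D lam \<mu> d y =
     (\<Sum>a\<in>Pow {1..d - 1}. c_star lam \<mu> (a \<union> {d}) *
        bracket D (rho lam \<mu> d) (alpha_star lam \<mu> (a \<union> {d})) y)"

end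

theory Submission
  imports Defs
begin

text \<open>
  Put \<open>m 0 = lam\<close>, \<open>m i = \<mu> i\<close>, \<open>r i = lam / m i\<close> and let \<open>prev a l\<close> be the largest element of
  \<open>a \<union> {0}\<close> below \<open>l\<close>. Then one minus the right-hand side is the single sum \<open>F\<close>, over all
  \<open>a \<subseteq> {1..D}\<close> including the empty set, of
  \<open>(-1) ^ card a * (\<Prod>l=1..D. (m l - m 0) / (m l - m (prev a l)))\<close> times the bracket with
  \<open>\<alpha> l = r (prev a l)\<close> and \<open>\<beta> = r (prev a (D + 1))\<close>. Each summand satisfies the interior balance
  equation. On \<open>y i = 0\<close> the defects of \<open>a\<close> and of \<open>a\<close> with \<open>i - 1\<close> toggled cancel, so \<open>F\<close> is
  harmonic; on \<open>bdry_B D\<close> the terms of \<open>a\<close> and of \<open>a\<close> with \<open>D\<close> toggled cancel, so \<open>F = 0\<close> there.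
  Moreover \<open>1 - F\<close> is bounded on \<open>B D\<close> and decays geometrically in the distance \<open>level\<close> to the
  boundary, while the surviving walk leaves every strip of bounded \<open>level\<close> in probability. Optional
  stopping then gives \<open>F y = P\<^sub>y(\<tau> = \<infinity>)\<close>.
\<close>

subsection \<open>Predecessors in a finite set of indices\<close>

text \<open>The bound \<open>k < l\<close> makes the maximum range over a finite set even if
  \<open>a\<close> is infinite, and the inserted 0 makes that set nonempty.\<close>

definition prev :: "nat set \<Rightarrow> nat \<Rightarrow> nat" where
  "prev a l = Max (insert 0 {k \<in> a. k < l})"

lemma prev_eqI:
  assumes "k \<in> a" "k < l" "\<And>k'. k' \<in> a \<Longrightarrow> k' < l \<Longrightarrow> k' \<le> k"
  shows "prev a l = k"
  unfolding prev_def by (rule Max_eqI) (use assms in auto)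

lemma prev_eq_0: "(\<And>k. k \<in> a \<Longrightarrow> l \<le> k) \<Longrightarrow> prev a l = 0"
  unfolding prev_def by (rule Max_eqI) force+

lemma prev_less: "0 < l \<Longrightarrow> prev a l < l"
  unfolding prev_def by (subst Max_less_iff) auto

lemma prev_in: "prev a l \<in> insert 0 a"
  using Max_in[of "insert 0 {k \<in> a. k < l}"] unfolding prev_def by auto

lemma prev_Suc: "prev a (Suc i) = (if i \<in> a then i else prev a i)"
proof (cases "i \<in> a")
  case True
  then show ?thesis by (auto intro: prev_eqI)
next
  case False
  then have "{k \<in> a. k < Suc i} = {k \<in> a. k < i}" using less_Suc_eq by auto
  then show ?thesis using False by (simp add: prev_def)
qed

lemma prev_insert:
  assumes "l \<le> x \<or> (\<exists>k\<in>a. x < k \<and> k < l)"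
  shows "prev (insert x a) l = prev a l"
  using assms
proof
  assume "l \<le> x"
  then have "{k \<in> insert x a. k < l} = {k \<in> a. k < l}" by auto
  then show ?thesis by (simp add: prev_def)
next
  assume "\<exists>k\<in>a. x < k \<and> k < l"
  then obtain k where k: "k \<in> a" "x < k" "k < l" by blast
  have "{k' \<in> insert x a. k' < l} = insert x {k' \<in> a. k' < l}" using k by auto
  then have "prev (insert x a) l = max x (prev a l)"
    by (simp add: prev_def insert_commute[of 0])
  moreover have "k \<le> prev a l" using k by (auto simp: prev_def intro!: Max_ge)
  ultimately show ?thesis using k by simp
qed

section \<open>Sorted enumeration of a finite set; \<open>alpha_star\<close> and
  \<open>c_star\<close> through predecessors\<close>

lemma elt_strict_mono:
  "finite a \<Longrightarrow> 1 \<le> i \<Longrightarrow> i < j \<Longrightarrow> j \<le> card a \<Longrightarrow> elt a i < elt a j"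
  unfolding elt_def
  by (rule sorted_wrt_nth_less[OF strict_sorted_list_of_set]) auto

lemma elt_image: "finite a \<Longrightarrow> elt a ` {1..card a} = a"
proof -
  assume a: "finite a"
  have "elt a ` {1..card a} = (!) (sorted_list_of_set a) ` (\<lambda>j. j - 1) ` {1..card a}"
    by (auto simp: elt_def)
  also have "(\<lambda>j::nat. j - 1) ` {1..card a} = {0..<card a}"
    by (auto simp: image_iff intro!: bexI[of _ "Suc _"])
  also have "(!) (sorted_list_of_set a) ` {0..<card a} = set (sorted_list_of_set a)"
    using nth_image[of "card a" "sorted_list_of_set a"] a by (simp add: lessThan_atLeast0)
  finally show ?thesis using a by simp
qed

lemma elt_insert_greater:
  assumes "finite a" "\<And>k. k \<in> a \<Longrightarrow> k < b"
  shows "1 \<le> j \<Longrightarrow> j \<le> card a \<Longrightarrow> elt (insert b a) j = elt a j"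
    and "elt (insert b a) (Suc (card a)) = b"
proof -
  have "b \<notin> a" using assms(2) by blast
  then have "sorted_list_of_set (insert b a) = insort b (sorted_list_of_set a)"
    using assms(1) by simp
  also have "\<dots> = sorted_list_of_set a @ [b]"
    by (rule sorted_insort_is_snoc) (use assms in \<open>auto intro: less_imp_le\<close>)
  finally have *: "sorted_list_of_set (insert b a) = sorted_list_of_set a @ [b]" .
  show "1 \<le> j \<Longrightarrow> j \<le> card a \<Longrightarrow> elt (insert b a) j = elt a j"
    using * assms(1) by (auto simp: elt_def nth_append)
  show "elt (insert b a) (Suc (card a)) = b"
    using * assms(1) by (simp add: elt_def nth_append)
qed

lemma elt_card:
  assumes "finite a" "a \<noteq> {}"
  shows "elt a (card a) = Max a"
proof (rule Max_eqI[symmetric])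
  have c: "1 \<le> card a" using assms by (simp add: Suc_leI card_gt_0_iff)
  then show "elt a (card a) \<in> a" using elt_image[OF assms(1)] by force
  fix k assume "k \<in> a"
  then obtain j where "j \<in> {1..card a}" "k = elt a j" using elt_image[OF assms(1)] by blast
  then show "k \<le> elt a (card a)"
    using elt_strict_mono[OF assms(1), of j "card a"] by (cases "j = card a") auto
qed (use assms in auto)

lemma elt_1_le:
  assumes "finite a" "k \<in> a"
  shows "elt a 1 \<le> k"
proof -
  obtain j where "j \<in> {1..card a}" "k = elt a j" using elt_image[OF assms(1)] assms(2) by blast
  then show ?thesis
    using elt_strict_mono[OF assms(1), of 1 j] by (cases "j = 1") auto
qed

lemma prev_elt:
  assumes "finite a" "1 \<le> j" "j < card a" "elt a j < l" "l \<le> elt a (j + 1)"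
  shows "prev a l = elt a j"
proof (rule prev_eqI)
  show "elt a j \<in> a" using elt_image[OF assms(1)] assms(2,3) by force
  fix k assume "k \<in> a" "k < l"
  then obtain i where i: "i \<in> {1..card a}" "k = elt a i" using elt_image[OF assms(1)] by blast
  show "k \<le> elt a j"
  proof (rule ccontr)
    assume n: "\<not> k \<le> elt a j"
    have "j < i"
    proof (rule ccontr)
      assume "\<not> j < i"
      then show False using n i elt_strict_mono[OF assms(1), of i j] assms(3)
        by (cases "i = j") auto
    qed
    then have "elt a (j + 1) \<le> k"
      using i elt_strict_mono[OF assms(1), of "j + 1" i] by (cases "i = j + 1") auto
    then show False using \<open>k < l\<close> assms(5) by simp
  qed
qed (use assms in auto)

text \<open>On the j-th gap between consecutive elements the predecessor is \<open>elt a j\<close>,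
  and strict monotonicity makes that j unique, so the \<open>THE\<close> in
  \<open>alpha_star\<close> is well determined. Up to the first element the predecessor is 0, where
  the rate \<open>lam\<close> gives the value 1.\<close>

lemma alpha_star_prev:
  assumes "finite a" "a \<noteq> {}" "0 \<notin> a" "lam \<noteq> 0"
  shows "alpha_star lam \<mu> a l = rho lam (\<mu>(0 := lam)) (prev a l)"
proof -
  have nz: "elt a j \<noteq> 0" if "j \<in> {1..card a}" for j
    using elt_image[OF assms(1)] assms(3) that by (metis imageI)
  have c: "1 \<le> card a" using assms by (simp add: Suc_leI card_gt_0_iff)
  consider "l \<le> elt a 1" | "elt a 1 < l" "l > elt a (card a)" | "elt a 1 < l" "l \<le> elt a (card a)"
    by linarith
  then show ?thesis
  proof cases
    case 1
    then have "prev a l = 0"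
      using elt_1_le[OF assms(1)] le_trans by (intro prev_eq_0) blast
    with 1 show ?thesis using assms(4) by (simp add: alpha_star_def rho_def)
  next
    case 2
    then have "prev a l = elt a (card a)"
      using elt_card[OF assms(1,2)] assms(1,2) by (intro prev_eqI) auto
    with 2 show ?thesis using nz[of "card a"] c by (simp add: alpha_star_def rho_def)
  next
    case 3
    \<comment> \<open>The gap containing \<open>l\<close> starts at the last element below
      \<open>l\<close>; maximality of \<open>j\<close> gives the bound \<open>j3\<close>.\<close>
    define j where "j = Max {j \<in> {1..card a}. elt a j < l}"
    have "j \<in> {j \<in> {1..card a}. elt a j < l}"
      unfolding j_def by (rule Max_in) (use 3 c in auto)
    then have j: "1 \<le> j" "j \<le> card a" "elt a j < l" by auto
    have j2: "j < card a" using 3 j by (metis le_neq_implies_less not_le)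
    have j3: "l \<le> elt a (j + 1)"
    proof (rule ccontr)
      assume "\<not> l \<le> elt a (j + 1)"
      then have "j + 1 \<le> j" unfolding j_def[symmetric]
        by (subst (2) j_def, intro Max_ge) (use j2 in auto)
      then show False by simp
    qed
    have "(THE j. j \<in> {1..<card a} \<and> elt a j < l \<and> l \<le> elt a (j + 1)) = j"
    proof (rule the_equality)
      fix i assume i: "i \<in> {1..<card a} \<and> elt a i < l \<and> l \<le> elt a (i + 1)"
      then have "elt a i = elt a j"
        using prev_elt[OF assms(1), of i l] prev_elt[OF assms(1) j(1) j2 j(3) j3] by simp
      then show "i = j"
        using i j elt_strict_mono[OF assms(1), of i j] elt_strict_mono[OF assms(1), of j i]
        by (cases i j rule: linorder_cases) auto
    qed (use j j2 j3 in auto)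
    moreover have "prev a l = elt a j" by (rule prev_elt) (use assms j j2 j3 in auto)
    ultimately show ?thesis using 3 nz[of j] j
      by (simp add: alpha_star_def rho_def)
  qed
qed

text \<open>A new maximum is appended to the sorted enumeration, so the double product gains exactly
  one block, from \<open>Max a + 1\<close> to \<open>b\<close>, and the exponent of -1 grows by
  one.\<close>

lemma c_star_insert_greater:
  assumes "finite a" "a \<noteq> {}" "\<And>k. k \<in> a \<Longrightarrow> k < b"
  shows "c_star lam \<mu> (insert b a) =
    - c_star lam \<mu> a * (\<Prod>l=Max a + 1..b. (\<mu> l - lam) / (\<mu> l - \<mu> (Max a)))"
proof -
  obtain n where n: "card a = Suc n" using assms(1,2) by (metis card_eq_0_iff not0_implies_Suc)
  have "b \<notin> a" using assms(3) by blast
  then have c: "card (insert b a) = Suc (Suc n)" using assms(1) n by simp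
  have e: "elt (insert b a) j = elt a j" if "1 \<le> j" "j \<le> Suc n" for j
    using elt_insert_greater(1)[of a b j] assms that n by simp
  have e': "elt (insert b a) (Suc (Suc n)) = b" "elt a (Suc n) = Max a"
    using elt_insert_greater(2)[of a b] elt_card[of a] assms n by simp_all
  have "(\<Prod>j=1..n. \<Prod>l=elt (insert b a) j + 1..elt (insert b a) (j + 1).
        (\<mu> l - lam) / (\<mu> l - \<mu> (elt (insert b a) j))) =
      (\<Prod>j=1..n. \<Prod>l=elt a j + 1..elt a (j + 1). (\<mu> l - lam) / (\<mu> l - \<mu> (elt a j)))"
    by (rule prod.cong) (auto simp: e)
  then show ?thesis using e[of "Suc n"] e' by (simp add: c_star_def n c)
qed

text \<open>On each block of \<open>c_star\<close> the predecessor is constant. Factors up to the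
  least element have predecessor 0 and equal 1, because \<open>\<mu> l \<noteq> lam\<close>; hence
  the single product may start at 1.\<close>

lemma c_star_prev:
  assumes "finite a" "a \<noteq> {}" "0 \<notin> a" "\<And>l. l \<in> {1..Max a} \<Longrightarrow> \<mu> l \<noteq> lam"
  shows "c_star lam \<mu> a = (-1) ^ (card a - 1) *
    (\<Prod>l=1..Max a. (\<mu> l - lam) / (\<mu> l - (\<mu>(0 := lam)) (prev a l)))"
  using assms
proof (induction rule: finite_linorder_max_induct)
  case (insert b A)
  define m where "m = \<mu>(0 := lam)"
  have Maxb: "Max (insert b A) = b"
    by (rule Max_eqI) (use insert in \<open>auto intro: less_imp_le\<close>)
  show ?case
  proof (cases "A = {}")
    case True
    have "prev {b} l = 0" if "l \<in> {1..b}" for l using that by (intro prev_eq_0) auto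
    then have "(\<Prod>l=1..b. (\<mu> l - lam) / (\<mu> l - (\<mu>(0 := lam)) (prev {b} l))) = 1"
      using insert.prems True by (intro prod.neutral) auto
    then show ?thesis using True by (simp add: c_star_def)
  next
    case False
    have MA: "Max A \<in> A" using False insert.hyps by simp
    then have "Max A < b" "Max A \<noteq> 0"
      using insert.hyps insert.prems by (blast, metis insertCI)
    note MA = MA this
    have "c_star lam \<mu> A = (-1) ^ (card A - 1) *
        (\<Prod>l=1..Max A. (\<mu> l - lam) / (\<mu> l - m (prev A l)))"
      unfolding m_def
    proof (rule insert.IH)
      show "\<mu> l \<noteq> lam" if "l \<in> {1..Max A}" for l
        using insert.prems(3)[of l] that MA Maxb by simp
    qed (use insert.prems False in auto)
    moreover have "(\<Prod>l=1..Max A. (\<mu> l - lam) / (\<mu> l - m (prev A l))) =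
        (\<Prod>l=1..Max A. (\<mu> l - lam) / (\<mu> l - m (prev (insert b A) l)))"
      by (rule prod.cong) (use MA in \<open>auto simp: prev_insert\<close>)
    moreover have "(\<Prod>l=Max A + 1..b. (\<mu> l - lam) / (\<mu> l - \<mu> (Max A))) =
        (\<Prod>l=Max A + 1..b. (\<mu> l - lam) / (\<mu> l - m (prev (insert b A) l)))"
    proof (rule prod.cong)
      fix l assume l: "l \<in> {Max A + 1..b}"
      have "prev (insert b A) l = Max A"
        by (rule prev_eqI) (use l MA insert.hyps in auto)
      then show "(\<mu> l - lam) / (\<mu> l - \<mu> (Max A)) =
          (\<mu> l - lam) / (\<mu> l - m (prev (insert b A) l))" using MA by (simp add: m_def)
    qed simp
    moreover have "{1..b} = {1..Max A} \<union> {Max A + 1..b}" using MA by auto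
    then have "(\<Prod>l=1..b. (\<mu> l - lam) / (\<mu> l - m (prev (insert b A) l))) =
      (\<Prod>l=1..Max A. (\<mu> l - lam) / (\<mu> l - m (prev (insert b A) l))) *
      (\<Prod>l=Max A + 1..b. (\<mu> l - lam) / (\<mu> l - m (prev (insert b A) l)))"
      by (simp only:) (rule prod.union_disjoint, auto)
    moreover have "b \<notin> A" using insert.hyps by blast
    then have "(-1::real) ^ (card (insert b A) - 1) = - ((-1) ^ (card A - 1))"
      using False insert.hyps by (cases "card A") (auto simp: card_eq_0_iff)
    ultimately show ?thesis
      using c_star_insert_greater[of A b lam \<mu>] False insert.hyps Maxb
      by (simp add: m_def)
  qed
qed simp

section \<open>Sums over all subsets, by pairing and by maximum\<close>

lemma sum_Pow_toggle:
  fixes g :: "'a set \<Rightarrow> real"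
  assumes "finite S" "x \<in> S" "\<And>a. a \<subseteq> S - {x} \<Longrightarrow> g (insert x a) = - g a"
  shows "(\<Sum>a\<in>Pow S. g a) = 0"
proof -
  have "Pow S = Pow (S - {x}) \<union> insert x ` Pow (S - {x})"
    using Pow_insert[of x "S - {x}"] assms(2) by (simp add: insert_absorb)
  then have "sum g (Pow S) = sum g (Pow (S - {x})) + sum g (insert x ` Pow (S - {x}))"
    using assms(1) by (simp only:) (rule sum.union_disjoint, auto)
  also have "sum g (insert x ` Pow (S - {x})) = (\<Sum>a\<in>Pow (S - {x}). g (insert x a))"
    by (rule sum.reindex_cong[of "insert x"]) (auto simp: inj_on_def)
  also have "\<dots> = - sum g (Pow (S - {x}))"
    using assms(3) by (simp add: sum_negf)
  finally show ?thesis by simp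
qed

text \<open>Nonempty subsets are sorted by their maximum \<open>d\<close>, which produces the outer
  sum over \<open>d\<close> of the theorem.\<close>

lemma sum_Pow_Max:
  fixes g :: "nat set \<Rightarrow> real"
  shows "(\<Sum>a\<in>Pow {1..n}. g a) = g {} + (\<Sum>d=1..n. \<Sum>a\<in>Pow {1..d - 1}. g (insert d a))"
proof (induction n)
  case (Suc n)
  have "{1..Suc n} = insert (Suc n) {1..n}" by auto
  then have "Pow {1..Suc n} = Pow {1..n} \<union> insert (Suc n) ` Pow {1..n}"
    by (simp only: Pow_insert)
  then have "sum g (Pow {1..Suc n}) = sum g (Pow {1..n}) + sum g (insert (Suc n) ` Pow {1..n})"
    by (simp only:) (rule sum.union_disjoint, auto)
  also have "sum g (insert (Suc n) ` Pow {1..n}) = (\<Sum>a\<in>Pow {1..n}. g (insert (Suc n) a))"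
  proof (rule sum.reindex_cong[of "insert (Suc n)"])
    have "Suc n \<notin> a" if "a \<in> Pow {1..n}" for a using that by auto
    then show "inj_on (insert (Suc n)) (Pow {1..n})" by (meson inj_onI insert_ident)
  qed auto
  finally show ?case using Suc.IH by simp
qed simp

subsection \<open>The harmonic function\<close>

locale tandem =
  fixes D :: nat and lam :: real and \<mu> :: "nat \<Rightarrow> real"
  assumes D: "D \<ge> 3"
    and lam_pos: "lam > 0"
    and total: "lam + (\<Sum>i=1..D. \<mu> i) = 1"
    and stable: "\<And>i. i \<in> {1..D} \<Longrightarrow> lam < \<mu> i"
    and distinct_mu: "\<And>i j. i \<in> {1..D} \<Longrightarrow> j \<in> {1..D} \<Longrightarrow> i \<noteq> j \<Longrightarrow> \<mu> i \<noteq> \<mu> j"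
begin

definition m :: "nat \<Rightarrow> real" where
  "m = \<mu>(0 := lam)"

definition r :: "nat \<Rightarrow> real" where
  "r = rho lam m"

text \<open>Numbered so that \<open>step i\<close> is the jump of probability \<open>m i\<close>: 0
  is an arrival, and i from 1 to \<open>D\<close> a service at station i.\<close>

definition step :: "nat \<Rightarrow> nat \<Rightarrow> int" where
  "step i = (if i = 0 then - e 1 else if i = 1 then e 1 + e 2
     else if i < D then - e i + e (i + 1) else - e D)"

definition level :: "(nat \<Rightarrow> int) \<Rightarrow> int" where
  "level y = y 1 - (\<Sum>j=2..D. y j)"

definition weight :: "nat set \<Rightarrow> real" where
  "weight a = (-1) ^ card a * (\<Prod>l=1..D. (m l - m 0) / (m l - m (prev a l)))"

definition mode :: "nat set \<Rightarrow> (nat \<Rightarrow> int) \<Rightarrow> real" where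
  "mode a = bracket D (r (prev a (D + 1))) (\<lambda>l. r (prev a l))"

definition F :: "(nat \<Rightarrow> int) \<Rightarrow> real" where
  "F y = (\<Sum>a\<in>Pow {1..D}. weight a * mode a y)"

lemma m_0 [simp]: "m 0 = lam" and m_pos [simp]: "i \<noteq> 0 \<Longrightarrow> m i = \<mu> i"
  by (simp_all add: m_def)

lemma m_gt_0: "i \<le> D \<Longrightarrow> m i > 0"
  using stable[of i] lam_pos by (cases "i = 0") auto

lemma m_inj: "i \<le> D \<Longrightarrow> j \<le> D \<Longrightarrow> i \<noteq> j \<Longrightarrow> m i \<noteq> m j"
  using stable[of i] stable[of j] distinct_mu[of i j]
  by (cases "i = 0"; cases "j = 0") auto

lemma sum_m: "(\<Sum>i\<le>D. m i) = 1"
proof -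
  have "{..D} = insert 0 {1..D}" by auto
  then show ?thesis using total by simp
qed

lemma r_0 [simp]: "r 0 = 1"
  using lam_pos by (simp add: r_def rho_def)

lemma r_eq: "i \<le> D \<Longrightarrow> r i = lam / m i"
  by (simp add: r_def rho_def)

lemma r_gt_0: "i \<le> D \<Longrightarrow> r i > 0"
  using m_gt_0 lam_pos by (simp add: r_eq)

lemma r_lt_1: "i \<in> {1..D} \<Longrightarrow> r i < 1"
  using stable[of i] lam_pos by (simp add: r_eq)

lemma r_le_1: "i \<le> D \<Longrightarrow> r i \<le> 1"
  using r_lt_1[of i] by (cases "i = 0") auto

lemma prev_le_D: "a \<subseteq> {1..D} \<Longrightarrow> prev a l \<le> D"
  using prev_in[of a l] by auto

lemma prev_1: "a \<subseteq> {1..D} \<Longrightarrow> prev a (Suc 0) = 0"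
  by (rule prev_eq_0) auto

text \<open>Places in which a service at \<open>i\<close> moves one unit from place \<open>i\<close>
  to place \<open>i + 1\<close>, the level being the last place \<open>D + 1\<close>. Place 1 is set
  to 0 instead, which is harmless since its base \<open>r (prev a 1)\<close> is 1.\<close>

definition coord :: "(nat \<Rightarrow> int) \<Rightarrow> nat \<Rightarrow> int" where
  "coord y l = (if l = 1 then 0 else if l = D + 1 then level y else y l)"

lemma mode_coord:
  assumes "a \<subseteq> {1..D}"
  shows "mode a y = (\<Prod>l=1..D + 1. r (prev a l) powi coord y l)"
proof -
  have "{1..D + 1} = insert 1 (insert (D + 1) {2..D})" using D by auto
  then have "(\<Prod>l=1..D + 1. r (prev a l) powi coord y l) =
      r (prev a (D + 1)) powi level y * (\<Prod>l=2..D. r (prev a l) powi coord y l)"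
    using D by (simp add: coord_def)
  also have "(\<Prod>l=2..D. r (prev a l) powi coord y l) = (\<Prod>l=2..D. r (prev a l) powi y l)"
    by (rule prod.cong) (auto simp: coord_def)
  finally show ?thesis by (simp add: mode_def bracket_def level_def)
qed

lemma level_add: "level (y + v) = level y + level v"
  by (simp add: level_def sum.distrib)

lemma level_e: "level (e i) = (if i = 1 then 1 else if i \<in> {2..D} then -1 else 0)"
  by (auto simp: level_def e_def)

lemma level_minus: "level (- v) = - level v"
  by (simp add: level_def sum_negf)

lemma level_diff: "level (v - w) = level v - level w"
  by (simp add: level_def sum_subtractf)

lemma level_step:
  assumes "i \<le> D"
  shows "level (step i) = (if i = 0 then -1 else if i = D then 1 else 0)"
  using D assms by (auto simp: step_def level_add level_minus level_diff level_e)

lemma coord_add: "coord (y + v) l = coord y l + coord v l"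
  by (simp add: coord_def level_add)

lemma coord_step:
  assumes "i \<in> {1..D}" "l \<in> {2..D + 1}"
  shows "coord (step i) l = (if l = i + 1 then 1 else 0) - (if l = i then 1 else 0)"
  using D assms level_step[of i] by (auto simp: coord_def step_def e_def)

lemma coord_step_0:
  assumes "l \<in> {1..D + 1}"
  shows "coord (step 0) l = (if l = D + 1 then -1 else 0)"
  using D assms level_step[of 0] by (auto simp: coord_def step_def e_def)

text \<open>The factor by which \<open>step i\<close> multiplies \<open>mode a\<close>. An arrival
  removes one unit from place \<open>D + 1\<close> without putting it elsewhere, whence the
  numerator 1.\<close>

definition ratio :: "nat set \<Rightarrow> nat \<Rightarrow> real" where
  "ratio a i = (if i = 0 then 1 else r (prev a (i + 1))) / r (prev a (if i = 0 then D + 1 else i))"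

lemma mode_step:
  assumes a: "a \<subseteq> {1..D}" and i: "i \<le> D"
  shows "mode a (y + step i) = mode a y * ratio a i"
proof -
  have nz: "r (prev a l) \<noteq> 0" for l using r_gt_0[OF prev_le_D[OF a]] by (simp add: less_imp_neq[symmetric])
  have "mode a (y + step i) =
      mode a y * (\<Prod>l=1..D + 1. r (prev a l) powi coord (step i) l)"
    using nz by (simp add: mode_coord[OF a] coord_add power_int_add prod.distrib)
  also have "(\<Prod>l=1..D + 1. r (prev a l) powi coord (step i) l) = ratio a i"
  proof (cases "i = 0")
    case True
    have "(\<Prod>l=1..D + 1. r (prev a l) powi coord (step i) l) =
        (\<Prod>l=1..D + 1. if l = D + 1 then inverse (r (prev a l)) else 1)"
      by (rule prod.cong) (auto simp only: True coord_step_0, auto)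
    then show ?thesis using True by (simp add: prod.delta ratio_def divide_inverse)
  next
    case False
    have "(\<Prod>l=1..D + 1. r (prev a l) powi coord (step i) l) =
        (\<Prod>l=1..D + 1. (if l = i + 1 then r (prev a l) else 1) *
          (if l = i then inverse (r (prev a l)) else 1))"
    proof (rule prod.cong)
      fix l assume l: "l \<in> {1..D + 1}"
      show "r (prev a l) powi coord (step i) l = (if l = i + 1 then r (prev a l) else 1) *
          (if l = i then inverse (r (prev a l)) else 1)"
      proof (cases "l = 1")
        case True
        \<comment> \<open>Place 1 has exponent 0 and base 1, so the factor that a service at station
          1 should leave there is trivial.\<close>
        then show ?thesis using prev_1[OF a] False by (auto simp: coord_def)
      next
        case False2: False
        then show ?thesis using coord_step[of i l] False i l by auto
      qed
    qed simp
    also have "\<dots> = r (prev a (i + 1)) * inverse (r (prev a i))"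
      using False i by (subst prod.distrib) (simp add: prod.delta)
    finally show ?thesis using False by (simp add: ratio_def divide_inverse)
  qed
  finally show ?thesis .
qed

text \<open>For a station outside \<open>a\<close>, \<open>prev a i\<close> and
  \<open>prev a (i + 1)\<close> agree, so its service does not change the mode. Only stations in
  \<open>a\<close> can create a defect at \<open>y i = 0\<close>.\<close>

lemma ratio_eq:
  assumes "i \<in> {1..D}" "a \<subseteq> {1..D}"
  shows "ratio a i = (if i \<in> a then m (prev a i) / m i else 1)"
  using assms m_gt_0[of i] lam_pos m_gt_0[OF prev_le_D[OF assms(2)], of i]
  by (auto simp: ratio_def prev_Suc r_eq prev_le_D)

text \<open>Each service term equals \<open>m i + lam / r (prev a i) - lam / r (prev a (i + 1))\<close>,
  so the sum telescopes.\<close>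

lemma sum_ratio:
  assumes a: "a \<subseteq> {1..D}"
  shows "(\<Sum>i\<le>D. m i * ratio a i) = 1"
proof -
  have tele: "(\<Sum>i=1..n. m i * ratio a i) =
      (\<Sum>i=1..n. m i) + lam - m (prev a (n + 1))" if "n \<le> D" for n
    using that
  proof (induction n)
    case 0
    then show ?case using prev_1[OF a] by simp
  next
    case (Suc n)
    then show ?case using ratio_eq[OF _ a, of "Suc n"] m_gt_0[of "Suc n"]
      by (auto simp: prev_Suc[of a "Suc n"])
  qed
  have "{..D} = insert 0 {1..D}" by auto
  \<comment> \<open>The arrival term restores exactly what the telescoped service terms
    lack.\<close>
  moreover have "lam * ratio a 0 = m (prev a (D + 1))"
    using lam_pos by (simp add: ratio_def r_eq[OF prev_le_D[OF a]])
  ultimately show ?thesis using tele[of D] total by simp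
qed

text \<open>Toggling \<open>i - 1\<close> in \<open>a\<close> changes only \<open>prev a i\<close>, hence only the factor \<open>l = i\<close> of the
  weight; against \<open>1 - ratio a i\<close> the denominator of that factor cancels.\<close>

lemma blocked_sum:
  assumes i: "i \<in> {2..D}" and y: "y i = 0"
  shows "(\<Sum>a\<in>Pow {1..D}. weight a * mode a y * (1 - ratio a i)) = 0"
proof (rule sum_Pow_toggle)
  show "i - 1 \<in> {1..D}" using i by auto
  fix a assume a: "a \<subseteq> {1..D} - {i - 1}"
  define a' where "a' = insert (i - 1) a"
  have sub: "a \<subseteq> {1..D}" "a' \<subseteq> {1..D}" using a i by (auto simp: a'_def)
  show "weight (insert (i - 1) a) * mode (insert (i - 1) a) y * (1 - ratio (insert (i - 1) a) i) =
    - (weight a * mode a y * (1 - ratio a i))"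
    unfolding a'_def[symmetric]
  proof (cases "i \<in> a")
    case False
    \<comment> \<open>Here predecessors above \<open>i\<close> change as well, but both defects
      vanish because \<open>i\<close> is in neither set.\<close>
    then show "weight a' * mode a' y * (1 - ratio a' i) = - (weight a * mode a y * (1 - ratio a i))"
      using ratio_eq[of i] sub i by (auto simp: a'_def)
  next
    case True
    have prev: "prev a' l = prev a l" if "l \<noteq> i" for l
      unfolding a'_def
      by (rule prev_insert) (use that True i in \<open>auto intro!: bexI[of _ i]\<close>)
    have "mode a' y = mode a y"
    proof -
      \<comment> \<open>The only factor whose base changes, at \<open>l = i\<close>, has exponent
        \<open>y i = 0\<close>.\<close>
      have "r (prev a' l) powi coord y l = r (prev a l) powi coord y l" for l
        using prev[of l] y i by (cases "l = i") (auto simp: coord_def)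
      then show ?thesis using mode_coord sub by simp
    qed
    moreover have "weight a' * (1 - ratio a' i) = - (weight a * (1 - ratio a i))"
    proof -
      have split: "(\<Prod>l=1..D. f l) = f i * (\<Prod>l\<in>{1..D} - {i}. f l)" for f :: "nat \<Rightarrow> real"
        using i by (intro prod.remove) auto
      define P where "P = (\<Prod>l\<in>{1..D} - {i}. (m l - m 0) / (m l - m (prev a l)))"
      have P': "P = (\<Prod>l\<in>{1..D} - {i}. (m l - m 0) / (m l - m (prev a' l)))"
        unfolding P_def by (rule prod.cong) (auto simp: prev)
      have "i - 1 \<notin> a" using a by blast
      then have "card a' = Suc (card a)"
        using finite_subset[OF sub(1)] by (simp add: a'_def)
      moreover have "(m i - m 0) / (m i - m (prev b i)) * P * (1 - ratio b i) = (m i - m 0) * P / m i"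
        if b: "b \<subseteq> {1..D}" "i \<in> b" for b
      proof -
        \<comment> \<open>Distinctness of the rates enters here, through
          \<open>prev b i < i\<close>.\<close>
        have "m i - m (prev b i) \<noteq> 0"
          using m_inj[of i "prev b i"] prev_le_D[OF b(1)] prev_less[of i b] i by auto
        moreover have "1 - ratio b i = (m i - m (prev b i)) / m i"
          using ratio_eq[of i b] b m_gt_0[of i] i by (simp add: diff_divide_distrib)
        ultimately show ?thesis by simp
      qed
      moreover have "i \<in> a'" using True by (simp add: a'_def)
      moreover have "weight a = (-1) ^ card a * ((m i - m 0) / (m i - m (prev a i)) * P)"
        unfolding weight_def P_def split ..
      moreover have "weight a' = (-1) ^ card a' * ((m i - m 0) / (m i - m (prev a' i)) * P)"
        unfolding weight_def P' split ..
      ultimately show ?thesis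
        using True sub by (simp only: mult.assoc) simp
    qed
    ultimately show "weight a' * mode a' y * (1 - ratio a' i) =
        - (weight a * mode a y * (1 - ratio a i))"
      by (metis mult.assoc mult.commute mult_minus_left)
  qed
qed simp

section \<open>Admissible moves and harmonicity of \<open>F\<close>\<close>

lemma step_in_lattice: "i \<le> D \<Longrightarrow> step i \<in> int_lattice D"
  using D by (auto simp: step_def int_lattice_def e_def)

lemma step_allowed:
  assumes "y \<in> Omega_Y D" "i \<le> D" "i \<in> {2..D} \<Longrightarrow> y i \<noteq> 0"
  shows "y + step i \<in> Omega_Y D"
proof -
  have "0 \<le> y j + step i j" if j: "j \<in> {2..D}" for j
  proof -
    have "0 \<le> y j" using assms(1) j by (simp add: Omega_Y_def)
    then show ?thesis using assms j D by (auto simp: step_def e_def)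
  qed
  then show ?thesis using assms(1) step_in_lattice[OF assms(2)]
    by (auto simp: Omega_Y_def int_lattice_def)
qed

lemma step_blocked:
  assumes "i \<in> {2..D}" "y i = 0"
  shows "y + step i \<notin> Omega_Y D"
proof -
  have "(y + step i) i < 0" using assms by (auto simp: step_def e_def)
  then show ?thesis using assms(1) by (auto simp: Omega_Y_def not_le intro!: bexI[of _ i])
qed

text \<open>A blocked jump leaves \<open>F\<close> unchanged, yet \<open>blocked_sum\<close> lets it
  be computed as if it were carried out in every mode. Harmonicity then needs no case distinction on
  the position.\<close>

lemma F_step:
  assumes "y \<in> Omega_Y D" "i \<le> D"
  shows "F (y + pi1 D y (step i)) = (\<Sum>a\<in>Pow {1..D}. weight a * mode a y * ratio a i)"
proof (cases "i \<in> {2..D} \<and> y i = 0")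
  case True
  then have "F (y + pi1 D y (step i)) = F y"
    using step_blocked[of i y] by (simp add: pi1_def)
  also have "\<dots> = (\<Sum>a\<in>Pow {1..D}. weight a * mode a y * ratio a i)"
    using blocked_sum[of i y] True by (simp add: F_def right_diff_distrib sum_subtractf)
  finally show ?thesis .
next
  case False
  then show ?thesis
    using step_allowed[OF assms] mode_step assms(2)
    by (auto simp: pi1_def F_def mult.assoc intro!: sum.cong)
qed

lemma F_harmonic:
  assumes "y \<in> Omega_Y D"
  shows "(\<Sum>i\<le>D. m i * F (y + pi1 D y (step i))) = F y"
proof -
  have "(\<Sum>i\<le>D. m i * F (y + pi1 D y (step i))) =
      (\<Sum>i\<le>D. \<Sum>a\<in>Pow {1..D}. weight a * mode a y * (m i * ratio a i))"
    using assms by (intro sum.cong) (auto simp: F_step sum_distrib_left mult_ac)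
  also have "\<dots> = (\<Sum>a\<in>Pow {1..D}. weight a * mode a y * (\<Sum>i\<le>D. m i * ratio a i))"
    by (subst sum.swap) (simp add: sum_distrib_left)
  also have "\<dots> = F y" by (simp add: sum_ratio F_def)
  finally show ?thesis .
qed

text \<open>Only place \<open>D + 1\<close> sees the element \<open>D\<close>, and there the
  exponent is the level, which is 0. The weight has factors up to \<open>D\<close> only, so toggling
  \<open>D\<close> changes just its sign.\<close>

lemma F_bdry:
  assumes "y \<in> bdry_B D"
  shows "F y = 0"
  unfolding F_def
proof (rule sum_Pow_toggle)
  show "D \<in> {1..D}" using D by simp
  fix a assume a: "a \<subseteq> {1..D} - {D}"
  have sub: "a \<subseteq> {1..D}" "insert D a \<subseteq> {1..D}" using a D by auto
  have prev: "prev (insert D a) l = prev a l" if "l \<le> D" for l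
    by (rule prev_insert) (use that in auto)
  have "coord y (D + 1) = 0" using assms D by (simp add: coord_def level_def bdry_B_def)
  then have "r (prev (insert D a) l) powi coord y l = r (prev a l) powi coord y l"
    if "l \<in> {1..D + 1}" for l
    using prev[of l] that by (cases "l = D + 1") auto
  then have "mode (insert D a) y = mode a y" using mode_coord sub by simp
  moreover have "weight (insert D a) = - weight a"
    using a finite_subset[OF sub(1)] prev by (simp add: weight_def card_insert_if subset_iff) blast
  ultimately show "weight (insert D a) * mode (insert D a) y = - (weight a * mode a y)" by simp
qed simp

section \<open>The closed formula as \<open>1 - F\<close>\<close>

lemma level_nonneg: "y \<in> B D \<Longrightarrow> 0 \<le> level y"
  by (simp add: B_def level_def)

lemma mode_empty: "mode {} y = 1"
  by (simp add: mode_def bracket_def prev_def)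

lemma weight_empty: "weight {} = 1"
proof -
  have "(\<Prod>l=1..D. (m l - m 0) / (m l - m (prev {} l))) = 1"
    using m_inj[of _ 0] by (intro prod.neutral) (auto simp: prev_def)
  then show ?thesis by (simp add: weight_def)
qed

text \<open>For a set with maximum \<open>d\<close>, \<open>c_star\<close> supplies the weight
  factors up to \<open>d\<close> and the outer product those above, where the predecessor is
  \<open>d\<close>. The sign exponents differ by one, hence the minus sign; the empty set
  contributes the 1.\<close>

lemma formula_eq_F:
  "(\<Sum>d=1..D. (\<Prod>l=d + 1..D. (\<mu> l - lam) / (\<mu> l - \<mu> d)) * h_star D lam \<mu> d y) = 1 - F y"
proof -
  have summand: "(\<Prod>l=d + 1..D. (\<mu> l - lam) / (\<mu> l - \<mu> d)) *
      (c_star lam \<mu> (a \<union> {d}) * bracket D (rho lam \<mu> d) (alpha_star lam \<mu> (a \<union> {d})) y) =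
      - (weight (insert d a) * mode (insert d a) y)"
    if d: "d \<in> {1..D}" and a: "a \<in> Pow {1..d - 1}" for d a
  proof -
    let ?a = "insert d a"
    have fin: "finite ?a" "?a \<noteq> {}" "0 \<notin> ?a" using a d finite_subset by auto
    have lt: "k < d" if "k \<in> a" for k using a that d by fastforce
    then have Maxd: "Max ?a = d"
      by (intro Max_eqI) (use fin in \<open>auto intro: less_imp_le\<close>)
    have prev: "prev ?a l = d" if "d < l" for l
      by (rule prev_eqI) (use that lt in \<open>auto intro: less_imp_le\<close>)
    have al: "alpha_star lam \<mu> ?a = (\<lambda>l. r (prev ?a l))"
      using alpha_star_prev[OF fin] lam_pos by (simp add: fun_eq_iff r_def m_def)
    have "mode ?a y = bracket D (rho lam \<mu> d) (alpha_star lam \<mu> ?a) y"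
      using prev[of "D + 1"] d by (simp add: mode_def al r_def rho_def)
    moreover have "c_star lam \<mu> ?a = (-1) ^ (card ?a - 1) *
        (\<Prod>l=1..d. (m l - m 0) / (m l - m (prev ?a l)))"
    proof -
      have "\<mu> l \<noteq> lam" if "l \<in> {1..Max ?a}" for l
        using stable[of l] that Maxd d by auto
      note c_star_prev[OF fin this]
      moreover have "(\<Prod>l=1..d. (\<mu> l - lam) / (\<mu> l - m (prev ?a l))) =
          (\<Prod>l=1..d. (m l - m 0) / (m l - m (prev ?a l)))"
        by (rule prod.cong) auto
      ultimately show ?thesis by (simp add: Maxd m_def)
    qed
    moreover have "(\<Prod>l=d + 1..D. (\<mu> l - lam) / (\<mu> l - \<mu> d)) =
        (\<Prod>l=d + 1..D. (m l - m 0) / (m l - m (prev ?a l)))"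
      by (rule prod.cong) (use prev d in auto)
    moreover have "{1..D} = {1..d} \<union> {d + 1..D}" using d by auto
    then have "(\<Prod>l=1..D. (m l - m 0) / (m l - m (prev ?a l))) =
        (\<Prod>l=1..d. (m l - m 0) / (m l - m (prev ?a l))) *
        (\<Prod>l=d + 1..D. (m l - m 0) / (m l - m (prev ?a l)))"
      by (simp only:) (rule prod.union_disjoint, auto)
    moreover have "(-1::real) ^ card ?a = - ((-1) ^ (card ?a - 1))"
      using fin by (cases "card ?a") auto
    ultimately show ?thesis by (simp add: weight_def)
  qed
  have "(\<Sum>d=1..D. (\<Prod>l=d + 1..D. (\<mu> l - lam) / (\<mu> l - \<mu> d)) * h_star D lam \<mu> d y) =
      (\<Sum>d=1..D. \<Sum>a\<in>Pow {1..d - 1}. - (weight (insert d a) * mode (insert d a) y))"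
    unfolding h_star_def sum_distrib_left using summand by (intro sum.cong refl) blast
  also have "\<dots> = 1 - F y"
    using sum_Pow_Max[of "\<lambda>a. weight a * mode a y" D]
    by (simp add: F_def sum_negf mode_empty weight_empty)
  finally show ?thesis .
qed

section \<open>Boundedness and geometric decay of \<open>1 - F\<close>\<close>

definition rmax :: real where
  "rmax = Max (r ` {1..D})"

lemma rmax: "0 < rmax" "rmax < 1" "i \<in> {1..D} \<Longrightarrow> r i \<le> rmax"
proof -
  have "rmax \<in> r ` {1..D}" unfolding rmax_def using D by (intro Max_in) auto
  then show "0 < rmax" "rmax < 1" using r_gt_0 r_lt_1 by auto
  show "i \<in> {1..D} \<Longrightarrow> r i \<le> rmax" by (simp add: rmax_def)
qed

definition weight_sum :: real where
  "weight_sum = (\<Sum>a\<in>Pow {1..D}. \<bar>weight a\<bar>)"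

text \<open>The term of the empty set is 1 and drops out. Every other mode has \<beta> =
  \<open>r (Max a)\<close>, at most \<open>rmax\<close>, raised to the level, and its remaining
  factors are at most 1. The case \<open>k = 0\<close> gives boundedness.\<close>

lemma one_minus_F_bound:
  assumes y: "y \<in> B D" and k: "int k \<le> level y"
  shows "\<bar>1 - F y\<bar> \<le> weight_sum * rmax ^ k"
proof -
  define n where "n = nat (level y)"
  have n: "level y = int n" "k \<le> n" using level_nonneg[OF y] k by (auto simp: n_def)
  have "mode a y \<in> {0..rmax ^ k}" if a: "a \<subseteq> {1..D}" "a \<noteq> {}" for a
  proof -
    have "finite a" using a(1) finite_subset by blast
    then have "prev a (D + 1) = Max a"
      using a by (intro prev_eqI) (auto simp: less_Suc_eq_le)
    moreover have "Max a \<in> {1..D}" using Max_in[OF \<open>finite a\<close> a(2)] a(1) by blast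
    ultimately have R: "0 < r (prev a (D + 1))" "r (prev a (D + 1)) \<le> rmax"
      using r_gt_0 rmax(3) by auto
    have "r (prev a (D + 1)) ^ n \<le> rmax ^ n" using R by (intro power_mono) auto
    also have "\<dots> \<le> rmax ^ k" using n rmax by (intro power_decreasing) auto
    finally have 1: "r (prev a (D + 1)) ^ n \<le> rmax ^ k" .
    have "0 \<le> r (prev a l) powi y l \<and> r (prev a l) powi y l \<le> 1" if "l \<in> {2..D}" for l
    proof -
      have "0 \<le> y l" using y that by (auto simp: B_def Omega_Y_def)
      then obtain p where "y l = int p" by (metis nonneg_int_cases)
      then show ?thesis using r_gt_0[OF prev_le_D[OF a(1)], of l] r_le_1[OF prev_le_D[OF a(1)], of l]
        by (simp add: power_le_one)
    qed
    then have 2: "(\<Prod>l=2..D. r (prev a l) powi y l) \<in> {0..1}"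
      by (auto intro!: prod_nonneg prod_le_1)
    have "mode a y = r (prev a (D + 1)) ^ n * (\<Prod>l=2..D. r (prev a l) powi y l)"
      using n by (simp add: mode_def bracket_def level_def)
    then show ?thesis using 1 2 R mult_mono[OF 1, of "\<Prod>l=2..D. r (prev a l) powi y l" 1]
      rmax by auto
  qed
  then have le: "\<bar>weight a * mode a y\<bar> \<le> \<bar>weight a\<bar> * rmax ^ k" if "a \<subseteq> {1..D}" "a \<noteq> {}" for a
    using that by (auto simp: abs_mult intro!: mult_left_mono)
  have "Pow {1..D} = insert {} (Pow {1..D} - {{}})" by auto
  then have "F y = 1 + (\<Sum>a\<in>Pow {1..D} - {{}}. weight a * mode a y)"
    unfolding F_def by (metis (no_types, lifting) finite_Diff finite_Pow_iff finite_atLeastAtMost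
      insert_Diff_single Diff_iff singletonI sum.insert mode_empty weight_empty mult_1)
  then have "\<bar>1 - F y\<bar> = \<bar>\<Sum>a\<in>Pow {1..D} - {{}}. weight a * mode a y\<bar>" by simp
  also have "\<dots> \<le> (\<Sum>a\<in>Pow {1..D} - {{}}. \<bar>weight a\<bar> * rmax ^ k)"
    by (rule order_trans[OF sum_abs]) (use le in \<open>auto intro!: sum_mono\<close>)
  also have "\<dots> \<le> (\<Sum>a\<in>Pow {1..D}. \<bar>weight a\<bar> * rmax ^ k)"
    by (rule sum_mono2) (use rmax in auto)
  finally show ?thesis by (simp add: weight_sum_def sum_distrib_right)
qed

subsection \<open>Paths of the walk\<close>

text \<open>Place \<open>j + 1\<close> separates \<open>step j\<close> from services at smaller
  stations, and place \<open>D + 1\<close> decreases only under an arrival.\<close>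

lemma inj_step: "inj_on step {..D}"
proof (rule inj_onI, rule ccontr)
  fix i j assume ij: "i \<in> {..D}" "j \<in> {..D}" "step i = step j" "i \<noteq> j"
  have *: False if "step i = step j" "0 < i" "i < j" "j \<le> D" for i j
    using coord_step[of i "j + 1"] coord_step[of j "j + 1"] that by auto
  show False
  proof (cases "i = 0 \<or> j = 0")
    case True
    then show False
      using ij coord_step[of i "D + 1"] coord_step[of j "D + 1"] coord_step_0[of "D + 1"] D
      by (auto split: if_splits)
  next
    case False
    then show False
      using ij *[of i j] *[of j i] by (cases i j rule: linorder_cases) auto
  qed
qed

lemma B_iff: "x \<in> B D \<longleftrightarrow> x \<in> Omega_Y D \<and> 0 \<le> level x"
  and bdry_B_iff: "x \<in> bdry_B D \<longleftrightarrow> x \<in> Omega_Y D \<and> level x = 0"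
  by (auto simp: B_def bdry_B_def level_def)

lemma level_zero: "level 0 = 0"
  by (simp add: level_def)

text \<open>Off the boundary the level is at least 1, and a jump lowers it by at most 1.\<close>

lemma next_in_B:
  assumes "x \<in> B D - bdry_B D" "i \<le> D"
  shows "x + pi1 D x (step i) \<in> B D"
  using assms level_step[OF assms(2)] by (auto simp: B_iff bdry_B_iff pi1_def level_add level_zero)

definition alive :: "(nat \<Rightarrow> int) \<Rightarrow> nat \<Rightarrow> (nat \<Rightarrow> nat \<Rightarrow> int) \<Rightarrow> bool" where
  "alive y k v \<longleftrightarrow> (\<forall>i\<le>k. Y D y v i \<in> B D - bdry_B D)"

lemma alive_Suc: "alive y (Suc k) v \<longleftrightarrow> alive y k v \<and> Y D y v (Suc k) \<in> B D - bdry_B D"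
  unfolding alive_def le_Suc_eq by auto

text \<open>The pathwise form of adaptedness, used in place of a filtration.\<close>

lemma Y_cong:
  "(\<And>i. i \<in> {1..k} \<Longrightarrow> v i = v' i) \<Longrightarrow> j \<le> k \<Longrightarrow> Y D y v j = Y D y v' j"
  by (induction j) auto

lemma alive_cong:
  "(\<And>i. i \<in> {1..k} \<Longrightarrow> v i = v' i) \<Longrightarrow> alive y k v = alive y k v'"
  unfolding alive_def using Y_cong[of k v v' _ y] by auto

lemma tau_finite_iff: "tau D p < \<infinity> \<longleftrightarrow> (\<exists>k. p k \<in> bdry_B D)"
  unfolding tau_def Inf_less_iff by auto

text \<open>The level drops by at most 1 per jump, so a path cannot leave \<open>B D\<close> without
  meeting \<open>bdry_B D\<close>.\<close>

lemma tau_finite_iff_not_alive: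
  assumes y: "y \<in> B D" and v: "\<And>k. v (Suc k) \<in> step ` {..D}"
  shows "tau D (Y D y v) < \<infinity> \<longleftrightarrow> \<not> (\<forall>k. alive y k v)"
proof -
  have "Y D y v k \<in> B D - bdry_B D" if "\<And>k. Y D y v k \<notin> bdry_B D" for k
  proof (induction k)
    case (Suc k)
    obtain i where "i \<le> D" "v (Suc k) = step i" using v[of k] by auto
    then have "Y D y v (Suc k) \<in> B D" using next_in_B[OF Suc] by simp
    then show ?case using that by blast
  qed (use y that[of 0] in auto)
  then show ?thesis unfolding tau_finite_iff alive_def by blast
qed

text \<open>The process \<open>F (Y k)\<close> killed on leaving the interior of \<open>B\<close>; nothing is lost on hitting
  \<open>bdry_B D\<close>, where \<open>F\<close> vanishes.\<close>

definition killed :: "(nat \<Rightarrow> int) \<Rightarrow> nat \<Rightarrow> (nat \<Rightarrow> nat \<Rightarrow> int) \<Rightarrow> real" where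
  "killed y k v = of_bool (alive y k v) * F (Y D y v k)"

lemma killed_cong:
  "(\<And>i. i \<in> {1..k} \<Longrightarrow> v i = v' i) \<Longrightarrow> killed y k v = killed y k v'"
  unfolding killed_def using alive_cong[of k v v' y] Y_cong[of k v v' k y] by auto

lemma weight_sum_nonneg: "0 \<le> weight_sum"
  by (simp add: weight_sum_def sum_nonneg)

lemma killed_bound: "\<bar>killed y k v\<bar> \<le> 1 + weight_sum"
proof (cases "alive y k v")
  case True
  then have "Y D y v k \<in> B D" by (simp add: alive_def)
  then show ?thesis
    using one_minus_F_bound[of "Y D y v k" 0] level_nonneg[of "Y D y v k"] True
    by (simp add: killed_def)
qed (use weight_sum_nonneg in \<open>simp add: killed_def\<close>)

text \<open>The jump lands in \<open>B D\<close>; if it lands on the boundary, \<open>F\<close>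
  vanishes, so the survival indicator at time \<open>k\<close> may replace the one at
  \<open>k + 1\<close>.\<close>

lemma killed_step:
  assumes "i \<le> D"
  shows "killed y (Suc k) (v(Suc k := step i)) =
    of_bool (alive y k v) * F (Y D y v k + pi1 D (Y D y v k) (step i))"
proof -
  let ?v = "v(Suc k := step i)"
  have Y: "Y D y ?v (Suc k) = Y D y v k + pi1 D (Y D y v k) (step i)"
    using Y_cong[of k ?v v k y] by simp
  have alive: "alive y k ?v = alive y k v" by (rule alive_cong) simp
  show ?thesis
  proof (cases "alive y k v")
    case True
    then have "Y D y ?v (Suc k) \<in> B D"
      unfolding Y using next_in_B assms by (simp add: alive_def)
    then show ?thesis using F_bdry[of "Y D y ?v (Suc k)"] True
      by (auto simp del: Y.simps simp: killed_def alive_Suc alive Y)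
  qed (simp add: killed_def alive_Suc alive)
qed

lemma killed_harmonic:
  "(\<Sum>i\<le>D. m i * killed y (Suc k) (v(Suc k := step i))) = killed y k v"
proof (cases "alive y k v")
  case True
  then have "Y D y v k \<in> Omega_Y D" by (simp add: alive_def B_def)
  then show ?thesis using True F_harmonic by (simp add: killed_step) (simp add: killed_def)
qed (simp add: killed_step, simp add: killed_def)

lemma level_step_0:
  assumes "alive y k v" "v (Suc k) = step 0"
  shows "level (Y D y v (Suc k)) = level (Y D y v k) - 1"
proof -
  have "Y D y v k \<in> Omega_Y D" using assms by (simp add: alive_def B_def)
  then have "Y D y v k + step 0 \<in> Omega_Y D" by (intro step_allowed) auto
  then show ?thesis using assms level_step[of 0] by (simp add: pi1_def level_add)
qed

end

subsection \<open>Optional stopping\<close>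

text \<open>For measurability: finite products of a countable discrete space are discrete, so every
  functional of finitely many jumps is measurable.\<close>

lemma countable_int_lattice: "countable (int_lattice D)"
proof -
  have "int_lattice D \<subseteq> (\<lambda>f i. if i \<in> {1..D} then f i else 0) ` (PiE {1..D} (\<lambda>_. UNIV))"
  proof
    fix v assume v: "v \<in> int_lattice D"
    then have "v = (\<lambda>i. if i \<in> {1..D} then restrict v {1..D} i else 0)"
      by (auto simp: int_lattice_def fun_eq_iff)
    then show "v \<in> (\<lambda>f i. if i \<in> {1..D} then f i else 0) ` (PiE {1..D} (\<lambda>_. UNIV))"
      by (rule image_eqI[where x = "restrict v {1..D}"]) simp
  qed
  moreover have "countable (PiE {1..D} (\<lambda>_. UNIV :: int set))"
    by (rule countable_PiE) auto
  ultimately show ?thesis by (meson countable_image countable_subset)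
qed

section \<open>Functionals of finitely many independent jumps\<close>

context prob_space
begin

context
  fixes S :: "'s set" and J :: "nat \<Rightarrow> 'a \<Rightarrow> 's" and G :: "(nat \<Rightarrow> 's) \<Rightarrow> real" and k :: nat
  assumes S: "countable S"
    and indep: "indep_vars (\<lambda>_. count_space S) J {1..}"
    and G: "\<And>v v'. (\<And>i. i \<in> {1..k} \<Longrightarrow> v i = v' i) \<Longrightarrow> G v = G v'"
begin

lemma G_restrict: "G (restrict v {1..k}) = G v"
  by (rule G) simp

lemma G_measurable_PiM: "G \<in> borel_measurable (PiM {1..k} (\<lambda>_. count_space S))"
  using count_space_PiM_finite[of "{1..k}" "\<lambda>_. S"] S by simp

lemma adapted_measurable: "(\<lambda>\<omega>. G (\<lambda>i. J i \<omega>)) \<in> borel_measurable M"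
proof -
  have "(\<lambda>\<omega>. restrict (\<lambda>i. J i \<omega>) {1..k}) \<in> measurable M (PiM {1..k} (\<lambda>_. count_space S))"
    using indep by (intro measurable_restrict) (auto simp: indep_vars_def)
  from measurable_compose[OF this G_measurable_PiM] show ?thesis by (simp only: G_restrict)
qed

lemma adapted_integrable:
  assumes "\<And>v. \<bar>G v\<bar> \<le> c"
  shows "integrable M (\<lambda>\<omega>. G (\<lambda>i. J i \<omega>))"
  by (rule integrable_const_bound[of _ c]) (use assms adapted_measurable in auto)

text \<open>The index blocks \<open>{1..k}\<close> and \<open>{Suc k}\<close> are disjoint, so the
  functional and the indicator are independent and the expectation factors.\<close>

lemma expectation_adapted_times_next:
  assumes bound: "\<And>v. \<bar>G v\<bar> \<le> c"
  shows "expectation (\<lambda>\<omega>. G (\<lambda>i. J i \<omega>) * of_bool (J (Suc k) \<omega> = s)) =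
    expectation (\<lambda>\<omega>. G (\<lambda>i. J i \<omega>)) * \<P>(\<omega> in M. J (Suc k) \<omega> = s)"
proof -
  let ?H = "\<lambda>f::nat \<Rightarrow> 's. of_bool (f (Suc k) = s) :: real"
  have mH: "?H \<in> borel_measurable (PiM {Suc k} (\<lambda>_. count_space S))"
    using count_space_PiM_finite[of "{Suc k}" "\<lambda>_. S"] S by simp
  have "indep_var borel (G \<circ> (\<lambda>\<omega>. restrict (\<lambda>i. J i \<omega>) {1..k}))
      borel (?H \<circ> (\<lambda>\<omega>. restrict (\<lambda>i. J i \<omega>) {Suc k}))"
    by (rule indep_var_compose[OF indep_var_restrict[OF indep] G_measurable_PiM mH]) auto
  then have iv: "indep_var borel (\<lambda>\<omega>. G (\<lambda>i. J i \<omega>)) borel (\<lambda>\<omega>. of_bool (J (Suc k) \<omega> = s) :: real)"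
    by (simp add: o_def G_restrict del: One_nat_def)
  then have "(\<lambda>\<omega>. of_bool (J (Suc k) \<omega> = s) :: real) \<in> borel_measurable M"
    by (rule indep_var_rv2)
  then have int: "integrable M (\<lambda>\<omega>. of_bool (J (Suc k) \<omega> = s) :: real)"
    by (intro integrable_const_bound[of _ 1]) auto
  have "expectation (\<lambda>\<omega>. of_bool (J (Suc k) \<omega> = s)) =
      expectation (indicator {\<omega> \<in> space M. J (Suc k) \<omega> = s} :: _ \<Rightarrow> real)"
    by (rule Bochner_Integration.integral_cong) (auto simp: indicator_def)
  then show ?thesis
    using indep_var_lebesgue_integral[OF iv adapted_integrable[OF bound] int]
    by (simp add: Int_def conj_commute)
qed

end

end

section \<open>The walk driven by random jumps\<close>

locale tandem_walk = tandem D lam \<mu> + prob_space M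
  for D lam \<mu> and M :: "'w measure" +
  fixes J :: "nat \<Rightarrow> 'w \<Rightarrow> (nat \<Rightarrow> int)"
  assumes indep: "indep_vars (\<lambda>_. count_space (int_lattice D)) J {1..}"
    and prob_step: "\<And>k i. k \<ge> 1 \<Longrightarrow> i \<le> D \<Longrightarrow> \<P>(\<omega> in M. J k \<omega> = step i) = m i"
begin

abbreviation traj :: "'w \<Rightarrow> nat \<Rightarrow> nat \<Rightarrow> int" where
  "traj \<omega> \<equiv> (\<lambda>i. J i \<omega>)"

lemmas adapted_measurable' = adapted_measurable[OF countable_int_lattice indep]
  and adapted_integrable' = adapted_integrable[OF countable_int_lattice indep]
  and expectation_next = expectation_adapted_times_next[OF countable_int_lattice indep]

text \<open>The \<open>D + 1\<close> jumps are distinct and their probabilities \<open>m i\<close>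
  add up to 1.\<close>

lemma AE_step: "AE \<omega> in M. \<forall>k. J (Suc k) \<omega> \<in> step ` {..D}"
proof (subst AE_all_countable, rule allI)
  fix k
  let ?A = "\<lambda>i. {\<omega> \<in> space M. J (Suc k) \<omega> = step i}"
  have meas: "?A i \<in> events" if "i \<le> D" for i
  proof -
    have "J (Suc k) \<in> measurable M (count_space (int_lattice D))"
      using indep by (auto simp: indep_vars_def)
    moreover have "{step i} \<in> sets (count_space (int_lattice D))"
      using step_in_lattice[OF that] by simp
    ultimately have "J (Suc k) -` {step i} \<inter> space M \<in> events" by (rule measurable_sets)
    moreover have "J (Suc k) -` {step i} \<inter> space M = ?A i" by auto
    ultimately show ?thesis by simp
  qed
  have "prob (\<Union>i\<le>D. ?A i) = (\<Sum>i\<le>D. prob (?A i))"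
    using meas inj_onD[OF inj_step]
    by (intro finite_measure_finite_Union) (auto simp: disjoint_family_on_def)
  also have "\<dots> = 1" using prob_step[of "Suc k"] sum_m by simp
  finally have "AE \<omega> in M. \<omega> \<in> (\<Union>i\<le>D. ?A i)" by (rule AE_prob_1)
  then show "AE \<omega> in M. J (Suc k) \<omega> \<in> step ` {..D}" by eventually_elim auto
qed

text \<open>Conditioning on the first \<open>k\<close> jumps, written out: the jump
  \<open>Suc k\<close> is independent of them and is replaced by each possible value with its
  probability.\<close>

lemma expectation_step:
  fixes G :: "(nat \<Rightarrow> nat \<Rightarrow> int) \<Rightarrow> real"
  assumes G: "\<And>v v'. (\<And>i. i \<in> {1..Suc k} \<Longrightarrow> v i = v' i) \<Longrightarrow> G v = G v'"
    and bound: "\<And>v. \<bar>G v\<bar> \<le> c"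
  shows "expectation (\<lambda>\<omega>. G (traj \<omega>)) =
    expectation (\<lambda>\<omega>. \<Sum>i\<le>D. m i * G ((traj \<omega>)(Suc k := step i)))"
proof -
  let ?G = "\<lambda>i v. G (v(Suc k := step i))"
  \<comment> \<open>Overwriting position \<open>Suc k\<close> leaves a functional of the first
    \<open>k\<close> jumps, to which independence applies.\<close>
  have G': "?G i v = ?G i v'" if "\<And>i. i \<in> {1..k} \<Longrightarrow> v i = v' i" for i v v'
    by (rule G) (use that in auto)
  have int: "integrable M (\<lambda>\<omega>. ?G i (traj \<omega>))" for i
    by (rule adapted_integrable'[OF G' bound])
  have int': "integrable M (\<lambda>\<omega>. ?G i (traj \<omega>) * of_bool (J (Suc k) \<omega> = step i))" for i
  proof (rule adapted_integrable'[where k = "Suc k" and c = c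
        and G = "\<lambda>v. ?G i v * of_bool (v (Suc k) = step i)"])
    fix v v' :: "nat \<Rightarrow> nat \<Rightarrow> int"
    assume v: "\<And>i. i \<in> {1..Suc k} \<Longrightarrow> v i = v' i"
    have "?G i v = ?G i v'" by (rule G') (use v in auto)
    then show "?G i v * of_bool (v (Suc k) = step i) = ?G i v' * of_bool (v' (Suc k) = step i)"
      using v[of "Suc k"] by simp
  next
    fix v :: "nat \<Rightarrow> nat \<Rightarrow> int"
    have "0 \<le> c" using bound[of v] by linarith
    then show "\<bar>?G i v * of_bool (v (Suc k) = step i)\<bar> \<le> c"
      using bound[of "v(Suc k := step i)"] by simp
  qed
  have "expectation (\<lambda>\<omega>. G (traj \<omega>)) =
      expectation (\<lambda>\<omega>. \<Sum>i\<le>D. ?G i (traj \<omega>) * of_bool (J (Suc k) \<omega> = step i))"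
  proof (rule integral_cong_AE)
    show "AE \<omega> in M. G (traj \<omega>) =
        (\<Sum>i\<le>D. ?G i (traj \<omega>) * of_bool (J (Suc k) \<omega> = step i))"
      using AE_step
    proof eventually_elim
      fix \<omega> assume "\<forall>k. J (Suc k) \<omega> \<in> step ` {..D}"
      then obtain j where j: "j \<le> D" "J (Suc k) \<omega> = step j" by blast
      then have "(traj \<omega>)(Suc k := step j) = traj \<omega>" by auto
      moreover have "(J (Suc k) \<omega> = step i) = (i = j)" if "i \<le> D" for i
        using j inj_onD[OF inj_step, of i j] that by auto
      then have "(\<Sum>i\<le>D. ?G i (traj \<omega>) * of_bool (J (Suc k) \<omega> = step i)) =
          (\<Sum>i\<le>D. if i = j then ?G i (traj \<omega>) else 0)"
        by (intro sum.cong) auto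
      ultimately show "G (traj \<omega>) =
          (\<Sum>i\<le>D. ?G i (traj \<omega>) * of_bool (J (Suc k) \<omega> = step i))"
        using j by simp
    qed
    show "(\<lambda>\<omega>. G (traj \<omega>)) \<in> borel_measurable M" by (rule adapted_measurable'[OF G])
    show "(\<lambda>\<omega>. \<Sum>i\<le>D. ?G i (traj \<omega>) * of_bool (J (Suc k) \<omega> = step i)) \<in> borel_measurable M"
      using int' by (intro borel_measurable_sum borel_measurable_integrable)
  qed
  also have "\<dots> = (\<Sum>i\<le>D. expectation (\<lambda>\<omega>. ?G i (traj \<omega>) * of_bool (J (Suc k) \<omega> = step i)))"
    using int' by (intro Bochner_Integration.integral_sum)
  also have "\<dots> = (\<Sum>i\<le>D. m i * expectation (\<lambda>\<omega>. ?G i (traj \<omega>)))"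
  proof (rule sum.cong)
    fix i assume "i \<in> {..D}"
    then show "expectation (\<lambda>\<omega>. ?G i (traj \<omega>) * of_bool (J (Suc k) \<omega> = step i)) =
        m i * expectation (\<lambda>\<omega>. ?G i (traj \<omega>))"
      using expectation_next[where G = "?G i" and k = k and c = c and s = "step i", OF G' bound]
        prob_step[of "Suc k" i]
      by simp
  qed simp
  also have "\<dots> = expectation (\<lambda>\<omega>. \<Sum>i\<le>D. m i * ?G i (traj \<omega>))"
    using int by (simp add: Bochner_Integration.integral_sum)
  finally show ?thesis .
qed

lemma expectation_killed:
  assumes "y \<in> B D"
  shows "expectation (\<lambda>\<omega>. killed y k (traj \<omega>)) = F y"
proof (induction k)
  case 0
  \<comment> \<open>If \<open>y\<close> is already on the boundary, both sides are 0.\<close>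
  have "killed y 0 v = F y" for v
    using assms F_bdry[of y] by (auto simp: killed_def alive_def)
  then show ?case using prob_space by simp
next
  case (Suc k)
  have "expectation (\<lambda>\<omega>. killed y (Suc k) (traj \<omega>)) =
      expectation (\<lambda>\<omega>. \<Sum>i\<le>D. m i * killed y (Suc k) ((traj \<omega>)(Suc k := step i)))"
    by (rule expectation_step[OF killed_cong killed_bound])
  then show ?case using Suc by (simp only: killed_harmonic)
qed

section \<open>Survival probabilities and escape from strips\<close>

definition p_alive :: "(nat \<Rightarrow> int) \<Rightarrow> nat \<Rightarrow> real" where
  "p_alive y k = expectation (\<lambda>\<omega>. of_bool (alive y k (traj \<omega>)))"

definition p_low :: "(nat \<Rightarrow> int) \<Rightarrow> nat \<Rightarrow> nat \<Rightarrow> real" where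
  "p_low y K k = expectation (\<lambda>\<omega>. of_bool (alive y k (traj \<omega>) \<and> level (Y D y (traj \<omega>) k) \<le> int K))"

lemma alive_measurable: "(\<lambda>\<omega>. of_bool (alive y k (traj \<omega>)) :: real) \<in> borel_measurable M"
  by (rule adapted_measurable'[where k = k and G = "\<lambda>v. of_bool (alive y k v)"])
    (rule arg_cong[where f = of_bool], rule alive_cong, blast)

lemma alive_integrable: "integrable M (\<lambda>\<omega>. of_bool (alive y k (traj \<omega>)) :: real)"
  by (rule integrable_const_bound[of _ 1]) (use alive_measurable in auto)

lemma low_cong:
  assumes "\<And>i. i \<in> {1..k} \<Longrightarrow> v i = v' i"
  shows "(alive y k v \<and> level (Y D y v k) \<le> int K) = (alive y k v' \<and> level (Y D y v' k) \<le> int K)"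
  using alive_cong[OF assms, where y = y] Y_cong[OF assms, where j = k and y = y] by auto

lemma low_integrable:
  "integrable M (\<lambda>\<omega>. of_bool (alive y k (traj \<omega>) \<and> level (Y D y (traj \<omega>) k) \<le> int K) :: real)"
  by (rule adapted_integrable'[where k = k and c = 1
        and G = "\<lambda>v. of_bool (alive y k v \<and> level (Y D y v k) \<le> int K)"])
    (rule arg_cong[where f = of_bool], rule low_cong, blast, simp)

lemma adapted_event:
  assumes "\<And>v v'. (\<And>i. i \<in> {1..k} \<Longrightarrow> v i = v' i) \<Longrightarrow> P v = P v'"
  shows "{\<omega> \<in> space M. P (traj \<omega>)} \<in> events"
proof -
  have "(\<lambda>\<omega>. of_bool (P (traj \<omega>)) :: real) \<in> borel_measurable M"
    by (rule adapted_measurable'[where k = k and G = "\<lambda>v. of_bool (P v)"])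
      (rule arg_cong[where f = of_bool], rule assms, blast)
  then have "(\<lambda>\<omega>. of_bool (P (traj \<omega>)) :: real) -` {1} \<inter> space M \<in> events"
    by (rule measurable_sets) simp
  moreover have "(\<lambda>\<omega>. of_bool (P (traj \<omega>)) :: real) -` {1} \<inter> space M = {\<omega> \<in> space M. P (traj \<omega>)}"
    by auto
  ultimately show ?thesis by simp
qed

lemma alive_event: "{\<omega> \<in> space M. alive y k (traj \<omega>)} \<in> events"
  by (rule adapted_event[where k = k and P = "alive y k"]) (rule alive_cong, blast)

lemma p_alive_eq: "p_alive y k = \<P>(\<omega> in M. alive y k (traj \<omega>))"
proof -
  have "p_alive y k = expectation (indicator {\<omega> \<in> space M. alive y k (traj \<omega>)} :: _ \<Rightarrow> real)"
    unfolding p_alive_def by (rule Bochner_Integration.integral_cong) (auto simp: indicator_def)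
  then show ?thesis by (simp add: Int_def conj_commute)
qed

lemma p_alive_tendsto:
  "p_alive y \<longlonglongrightarrow> \<P>(\<omega> in M. \<forall>k. alive y k (traj \<omega>))"
proof -
  let ?A = "\<lambda>k. {\<omega> \<in> space M. alive y k (traj \<omega>)}"
  have "decseq ?A" by (rule decseq_SucI) (auto simp: alive_Suc)
  then have "(\<lambda>k. prob (?A k)) \<longlonglongrightarrow> prob (\<Inter>k. ?A k)"
    using alive_event by (intro finite_Lim_measure_decseq) auto
  moreover have "(\<Inter>k. ?A k) = {\<omega> \<in> space M. \<forall>k. alive y k (traj \<omega>)}" by auto
  moreover have "p_alive y = (\<lambda>k. prob (?A k))" by (simp add: p_alive_eq fun_eq_iff)
  ultimately show ?thesis by simp
qed

text \<open>From level at most \<open>K + 1\<close> an arrival, always admissible and of probability \<open>lam\<close>, leads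
  to level at most \<open>K\<close> or to the boundary, and the probability of reaching the boundary at time
  \<open>k + 1\<close> tends to \<open>0\<close>. This replaces any appeal to the drift of the walk.\<close>

lemma p_low_tendsto_0: "p_low y K \<longlonglongrightarrow> 0"
proof (induction K)
  case 0
  \<comment> \<open>A surviving path has level at least 1.\<close>
  have "(alive y k v \<and> level (Y D y v k) \<le> int 0) = False" for k v
    by (auto simp: alive_def B_iff bdry_B_iff)
  then have "p_low y 0 = (\<lambda>_. 0)" by (intro ext) (simp only: p_low_def of_bool_eq, simp)
  then show ?case by simp
next
  case (Suc K)
  have "lam * p_low y (Suc K) k \<le> p_alive y k - p_alive y (Suc k) + p_low y K (Suc k)" for k
  proof -
    let ?low = "\<lambda>v. alive y k v \<and> level (Y D y v k) \<le> int (Suc K)"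
    have low: "of_bool (?low v) = (of_bool (?low v') :: real)"
      if "\<And>i. i \<in> {1..k} \<Longrightarrow> v i = v' i" for v v'
      using low_cong[OF that] by (rule arg_cong)
    have "lam * p_low y (Suc K) k =
        expectation (\<lambda>\<omega>. of_bool (?low (traj \<omega>)) * of_bool (J (Suc k) \<omega> = step 0))"
      using expectation_next[where k = k and G = "\<lambda>v. of_bool (?low v)" and c = 1 and s = "step 0", OF low]
        prob_step[of "Suc k" 0] by (simp add: p_low_def)
    also have "\<dots> \<le> expectation (\<lambda>\<omega>. of_bool (alive y k (traj \<omega>)) - of_bool (alive y (Suc k) (traj \<omega>)) +
        of_bool (alive y (Suc k) (traj \<omega>) \<and> level (Y D y (traj \<omega>) (Suc k)) \<le> int K))"
    proof (rule integral_mono')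
      fix \<omega>
      show "of_bool (?low (traj \<omega>)) * of_bool (J (Suc k) \<omega> = step 0) \<le>
        (of_bool (alive y k (traj \<omega>)) - of_bool (alive y (Suc k) (traj \<omega>)) +
        of_bool (alive y (Suc k) (traj \<omega>) \<and> level (Y D y (traj \<omega>) (Suc k)) \<le> int K) :: real)"
        using level_step_0[of y k "traj \<omega>"] by (auto simp del: Y.simps simp: alive_Suc)
    qed (intro Bochner_Integration.integrable_add Bochner_Integration.integrable_diff
        alive_integrable low_integrable, auto simp del: Y.simps simp: alive_Suc)
    also have "\<dots> = p_alive y k - p_alive y (Suc k) + p_low y K (Suc k)"
      using alive_integrable low_integrable
      by (simp del: Y.simps add: p_alive_def p_low_def)
    finally show ?thesis .
  qed
  then have le: "p_low y (Suc K) k \<le> (p_alive y k - p_alive y (Suc k) + p_low y K (Suc k)) / lam" for k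
    using lam_pos by (simp add: field_simps)
  \<comment> \<open>Consecutive survival probabilities have the same limit, so their difference
    tends to 0.\<close>
  have "(\<lambda>k. (p_alive y k - p_alive y (Suc k) + p_low y K (Suc k)) / lam) \<longlonglongrightarrow> (l - l + 0) / lam"
    if "p_alive y \<longlonglongrightarrow> l" for l
    using that lam_pos
    by (intro tendsto_intros LIMSEQ_Suc[OF that] LIMSEQ_Suc[OF Suc]) auto
  from this[OF p_alive_tendsto]
  have "(\<lambda>k. (p_alive y k - p_alive y (Suc k) + p_low y K (Suc k)) / lam) \<longlonglongrightarrow> 0" by simp
  then show ?case
    by (rule tendsto_sandwich[OF _ _ tendsto_const, rotated 2])
      (use le in \<open>auto simp: p_low_def intro!: always_eventually Bochner_Integration.integral_nonneg\<close>)
qed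

text \<open>\<open>F y\<close> is the mean of \<open>killed\<close>, and on survival the distance of
  \<open>F\<close> from 1 is at most \<open>weight_sum\<close> at levels up to \<open>K\<close> and
  at most \<open>weight_sum * rmax ^ K\<close> beyond.\<close>

lemma F_near_p_alive:
  assumes "y \<in> B D"
  shows "\<bar>p_alive y k - F y\<bar> \<le> weight_sum * (p_low y K k + rmax ^ K)"
proof -
  let ?low = "\<lambda>v. alive y k v \<and> level (Y D y v k) \<le> int K"
  have int: "integrable M (\<lambda>\<omega>. killed y k (traj \<omega>))"
    by (rule adapted_integrable'[OF killed_cong killed_bound])
  have "p_alive y k - F y = expectation (\<lambda>\<omega>. of_bool (alive y k (traj \<omega>)) - killed y k (traj \<omega>))"
    using alive_integrable int expectation_killed[OF assms, of k] by (simp add: p_alive_def)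
  also have "\<bar>\<dots>\<bar> \<le> expectation (\<lambda>\<omega>. \<bar>of_bool (alive y k (traj \<omega>)) - killed y k (traj \<omega>)\<bar>)"
    by (rule integral_abs_bound)
  also have "\<dots> \<le> expectation (\<lambda>\<omega>. weight_sum * (of_bool (?low (traj \<omega>)) + rmax ^ K))"
  proof (rule integral_mono')
    fix \<omega>
    let ?x = "Y D y (traj \<omega>) k"
    show "\<bar>of_bool (alive y k (traj \<omega>)) - killed y k (traj \<omega>)\<bar> \<le>
        weight_sum * (of_bool (?low (traj \<omega>)) + rmax ^ K)"
    proof (cases "alive y k (traj \<omega>)")
      case True
      then have x: "?x \<in> B D" by (simp add: alive_def)
      have "\<bar>1 - F ?x\<bar> \<le> weight_sum * (of_bool (?low (traj \<omega>)) + rmax ^ K)"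
      proof (cases "level ?x \<le> int K")
        case low: True
        have "weight_sum * 1 \<le> weight_sum * (of_bool (?low (traj \<omega>)) + rmax ^ K)"
          using low True rmax(1) weight_sum_nonneg by (intro mult_left_mono) auto
        then show ?thesis using one_minus_F_bound[OF x, of 0] level_nonneg[OF x] by simp
      next
        case False
        then show ?thesis using one_minus_F_bound[OF x, of K] by simp
      qed
      then show ?thesis using True by (simp add: killed_def)
    qed (use weight_sum_nonneg rmax(1) in \<open>simp add: killed_def\<close>)
  qed (use low_integrable weight_sum_nonneg rmax(1) in auto)
  also have "\<dots> = weight_sum * (p_low y K k + rmax ^ K)"
    using low_integrable by (simp add: p_low_def prob_space)
  finally show ?thesis .
qed

text \<open>First \<open>k\<close> tends to infinity with \<open>K\<close> fixed, removing
  \<open>p_low\<close>; then \<open>K\<close> tends to infinity, removing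
  \<open>rmax ^ K\<close>.\<close>

lemma prob_always_alive:
  assumes "y \<in> B D"
  shows "\<P>(\<omega> in M. \<forall>k. alive y k (traj \<omega>)) = F y"
proof -
  let ?p = "\<P>(\<omega> in M. \<forall>k. alive y k (traj \<omega>))"
  have bound: "\<bar>?p - F y\<bar> \<le> weight_sum * (0 + rmax ^ K)" for K
  proof (rule LIMSEQ_le)
    show "(\<lambda>k. \<bar>p_alive y k - F y\<bar>) \<longlonglongrightarrow> \<bar>?p - F y\<bar>"
      by (intro tendsto_intros p_alive_tendsto)
    show "(\<lambda>k. weight_sum * (p_low y K k + rmax ^ K)) \<longlonglongrightarrow> weight_sum * (0 + rmax ^ K)"
      by (intro tendsto_intros p_low_tendsto_0)
  qed (use F_near_p_alive[OF assms] in blast)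
  have "(\<lambda>K. weight_sum * (0 + rmax ^ K)) \<longlonglongrightarrow> weight_sum * (0 + 0)"
    using rmax by (intro tendsto_intros LIMSEQ_realpow_zero) auto
  then have "\<bar>?p - F y\<bar> \<le> weight_sum * (0 + 0)"
    by (rule LIMSEQ_le_const) (use bound in blast)
  then show ?thesis by simp
qed

text \<open>Almost surely all jumps are steps, so hitting the boundary and surviving forever are
  complementary up to a null set.\<close>

lemma prob_tau_finite:
  assumes y: "y \<in> B D"
  shows "\<P>(\<omega> in M. tau D (Y D y (traj \<omega>)) < \<infinity>) = 1 - F y"
proof -
  let ?A = "{\<omega> \<in> space M. \<forall>k. alive y k (traj \<omega>)}"
  have A: "?A \<in> events" using alive_event by (intro sets.sets_Collect_countable_All) auto
  have hit: "{\<omega> \<in> space M. Y D y (traj \<omega>) k \<in> bdry_B D} \<in> events" for k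
    by (rule adapted_event[where k = k and P = "\<lambda>v. Y D y v k \<in> bdry_B D"])
      (subst Y_cong[of k _ _ k y], auto)
  have "\<P>(\<omega> in M. tau D (Y D y (traj \<omega>)) < \<infinity>) = prob (space M - ?A)"
  proof (rule finite_measure_eq_AE)
    show "AE \<omega> in M. (\<omega> \<in> {\<omega> \<in> space M. tau D (Y D y (traj \<omega>)) < \<infinity>}) = (\<omega> \<in> space M - ?A)"
      using AE_step by eventually_elim (use tau_finite_iff_not_alive[OF y] in auto)
    show "{\<omega> \<in> space M. tau D (Y D y (traj \<omega>)) < \<infinity>} \<in> events"
      unfolding tau_finite_iff using hit by (intro sets.sets_Collect_countable_Ex) auto
  qed (use A in auto)
  then show ?thesis using prob_compl[OF A] prob_always_alive[OF y] by simp
qed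

end

theorem theorem4p1:
  fixes D :: nat and lam :: real and \<mu> :: "nat \<Rightarrow> real"
    and M :: "'w measure" and J :: "nat \<Rightarrow> 'w \<Rightarrow> (nat \<Rightarrow> int)" and y :: "nat \<Rightarrow> int"
  assumes D: "D \<ge> 3"
    and lam_pos: "lam > 0"
    and mu_pos: "\<And>i. i \<in> {1..D} \<Longrightarrow> \<mu> i > 0"
    and total: "lam + (\<Sum>i=1..D. \<mu> i) = 1"
    and stable: "\<And>i. i \<in> {1..D} \<Longrightarrow> lam < \<mu> i"
    and M: "prob_space M"
    and indep: "prob_space.indep_vars M (\<lambda>_. count_space (int_lattice D)) J {1..}"
    and J_arrival: "\<And>k. k \<ge> 1 \<Longrightarrow> \<P>(\<omega> in M. J k \<omega> = - e 1) = lam"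
    and J_first: "\<And>k. k \<ge> 1 \<Longrightarrow> \<P>(\<omega> in M. J k \<omega> = e 1 + e 2) = \<mu> 1"
    and J_mid: "\<And>k i. k \<ge> 1 \<Longrightarrow> i \<in> {2..D - 1} \<Longrightarrow>
                  \<P>(\<omega> in M. J k \<omega> = - e i + e (i + 1)) = \<mu> i"
    and J_last: "\<And>k. k \<ge> 1 \<Longrightarrow> \<P>(\<omega> in M. J k \<omega> = - e D) = \<mu> D"
    and distinct_mu: "\<And>i j. i \<in> {1..D} \<Longrightarrow> j \<in> {1..D} \<Longrightarrow> i \<noteq> j \<Longrightarrow> \<mu> i \<noteq> \<mu> j"
    and y: "y \<in> B D"
  shows "\<P>(\<omega> in M. tau D (Y D y (\<lambda>k. J k \<omega>)) < \<infinity>) =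
         (\<Sum>d=1..D. (\<Prod>l=d + 1..D. (\<mu> l - lam) / (\<mu> l - \<mu> d)) * h_star D lam \<mu> d y)"
proof -
  interpret prob_space M by (rule M)
  interpret tandem D lam \<mu>
    by unfold_locales (use D lam_pos total stable distinct_mu in auto)
  interpret tandem_walk D lam \<mu> M J
  proof unfold_locales
    show "indep_vars (\<lambda>_. count_space (int_lattice D)) J {1..}" by (rule indep)
    fix k i :: nat assume k: "k \<ge> 1" and "i \<le> D"
    then consider "i = 0" | "i = 1" | "i \<in> {2..D - 1}" | "i = D" "i \<ge> 2" using D by force
    then show "\<P>(\<omega> in M. J k \<omega> = step i) = m i"
    proof cases
      case 3
      then have "step i = - e i + e (i + 1)" by (auto simp: step_def)
      with 3 show ?thesis using J_mid[OF k 3] by simp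
    qed (use D J_arrival[OF k] J_first[OF k] J_last[OF k] in \<open>simp_all add: step_def\<close>)
  qed
  show ?thesis using prob_tau_finite[OF y] formula_eq_F[of y] by simp
qed

end
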